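(* Let $\Sigma$ be a finite alphabet, $d\ge 1$ and $n\ge 0$ integers. Then the set $\mathcal{I}_n^{loc}$ of locally invariant probability measures on $\Omega_n=\Sigma^{\Lambda_n}$ is a polytope whose extreme points are measures with rational range, that is, every extreme point $\mu$ of $\mathcal{I}_n^{loc}$ satisfies $\mu(A)\in\mathbb{Q}$ for all $A\subseteq\Omega_n$.
   Context: $\Lambda_n=\{-n,\ldots,n\}^d\subseteq\mathbb{Z}^d$, $\Omega_n=\Sigma^{\Lambda_n}$, and $\mathcal{P}_n=\mathcal{P}(\Omega_n)$ is the finite-dimensional simplex of probability measures on $\Omega_n$, viewed inside the real vector space of functions $\Omega_n\to\mathbb{R}$. For a finite set $E\subseteq\mathbb{Z}^d$, a pattern $a\in\Sigma^E$ and $u\in\mathbb{Z}^d$, the translated pattern $\Theta^u a\in\Sigma^{E-u}$ is defined by $(\Theta^u a)_v=a_{v+u}$. For $E\subseteq\Lambda_n$ and $a\in\Sigma^E$, $[a]_n=\{b\in\Omega_n : b|_E=a\}$. A measure $\mu\in\mathcal{P}_n$ is locally invariant if $\mu([a]_n)=\mu([\Theta^u a]_n)$ for every $E\subseteq\Lambda_n$, every $a\in\Sigma^E$ and every $u\in\mathbb{Z}^d$ with $E-u\subseteq\Lambda_n$; the set of these measures is $\mathcal{I}_n^{loc}$. A polytope is the convex hull of a finite set. *)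

theory Defs
  imports "HOL-Analysis.Analysis" "HOL-Analysis.Finite_Function_Topology"
begin

text \<open>
  The lattice is \<open>int ^ 'd\<close>, of dimension \<open>CARD('d) \<ge> 1\<close>.  The alphabet is a set \<open>\<Sigma>\<close>, and a
  pattern on \<open>E\<close> is an element of \<open>E \<rightarrow>\<^sub>E \<Sigma>\<close>, i.e. it is \<open>undefined\<close> outside \<open>E\<close>.
\<close>

definition box_sites :: "nat \<Rightarrow> (int ^ 'd::finite) set" where
  "box_sites n = {v. \<forall>i. v $ i \<in> {- int n..int n}}"

definition configs :: "'a set \<Rightarrow> nat \<Rightarrow> (int ^ 'd::finite \<Rightarrow> 'a) set" where
  "configs \<Sigma> n = box_sites n \<rightarrow>\<^sub>E \<Sigma>"

definition translate_set :: "int ^ 'd::finite \<Rightarrow> (int ^ 'd) set \<Rightarrow> (int ^ 'd) set" where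
  "translate_set u E = (\<lambda>v. v - u) ` E"

definition translate_pattern ::
    "int ^ 'd::finite \<Rightarrow> (int ^ 'd) set \<Rightarrow> (int ^ 'd \<Rightarrow> 'a) \<Rightarrow> (int ^ 'd \<Rightarrow> 'a)" where
  "translate_pattern u E a = restrict (\<lambda>v. a (v + u)) (translate_set u E)"

definition cylinder ::
    "'a set \<Rightarrow> nat \<Rightarrow> (int ^ 'd::finite) set \<Rightarrow> (int ^ 'd \<Rightarrow> 'a) \<Rightarrow> (int ^ 'd \<Rightarrow> 'a) set" where
  "cylinder \<Sigma> n E a = {b \<in> configs \<Sigma> n. restrict b E = a}"

text \<open>
  The space of real functions on \<open>configs \<Sigma> n\<close> (a finite set when \<open>\<Sigma>\<close> is finite) is represented
  by the subspace of \<open>(int ^ 'd \<Rightarrow> 'a) \<Rightarrow>\<^sub>0 real\<close> consisting of the functions supported on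
  \<open>configs \<Sigma> n\<close>; unlike the plain function type, this type is an instance of \<open>real_vector\<close>.
  A probability measure is given by its mass function.
\<close>

definition mass :: "('b \<Rightarrow>\<^sub>0 real) \<Rightarrow> 'b set \<Rightarrow> real" where
  "mass \<mu> A = (\<Sum>b\<in>A. Poly_Mapping.lookup \<mu> b)"

definition prob_measures :: "'a set \<Rightarrow> nat \<Rightarrow> ((int ^ 'd::finite \<Rightarrow> 'a) \<Rightarrow>\<^sub>0 real) set" where
  "prob_measures \<Sigma> n =
     {\<mu>. Poly_Mapping.keys \<mu> \<subseteq> configs \<Sigma> n \<and>
          (\<forall>b. 0 \<le> Poly_Mapping.lookup \<mu> b) \<and> mass \<mu> (configs \<Sigma> n) = 1}"

definition locally_invariant ::
    "'a set \<Rightarrow> nat \<Rightarrow> ((int ^ 'd::finite \<Rightarrow> 'a) \<Rightarrow>\<^sub>0 real) \<Rightarrow> bool" where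
  "locally_invariant \<Sigma> n \<mu> \<longleftrightarrow>
     (\<forall>E a u. E \<subseteq> box_sites n \<longrightarrow> a \<in> E \<rightarrow>\<^sub>E \<Sigma> \<longrightarrow> translate_set u E \<subseteq> box_sites n \<longrightarrow>
        mass \<mu> (cylinder \<Sigma> n E a) =
        mass \<mu> (cylinder \<Sigma> n (translate_set u E) (translate_pattern u E a)))"

definition loc_inv_measures :: "'a set \<Rightarrow> nat \<Rightarrow> ((int ^ 'd::finite \<Rightarrow> 'a) \<Rightarrow>\<^sub>0 real) set" where
  "loc_inv_measures \<Sigma> n = {\<mu> \<in> prob_measures \<Sigma> n. locally_invariant \<Sigma> n \<mu>}"

end

theory Submission
  imports Defs
begin

text \<open>
  A point \<open>\<mu>\<close> of a simplex cut by homogeneous linear equations can be moved in both directions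
  along any nonzero solution \<open>d\<close> of the homogeneous system supported on \<open>keys \<mu>\<close>, until
  the support shrinks. Hence such a point is not extreme, and by induction on the support every point
  is a convex combination of points for which there is no such \<open>d\<close>. The latter points are determined
  by their supports, so they are finitely many. They are rational because a \<open>\<rat>\<close>-linear
  projection \<open>\<real> \<rightarrow> \<rat>\<close> applied to the coordinates of \<open>\<mu>\<close> gives another solution of
  the same equations, which have integer coefficients, on the same support.
\<close>

subsection \<open>A rational projection of the reals\<close>

text \<open>The reals form a vector space over the rationals in which \<open>{1}\<close> is
  independent, so sending 1 to 1 extends to a linear map into the rationals. Its values are embedded
  back into the reals so that it can act on mass functions.\<close>

lemma rational_projection:
  obtains \<phi> :: "real \<Rightarrow> real"
  where "\<And>x y. \<phi> (x + y) = \<phi> x + \<phi> y" "\<phi> 1 = 1" "\<And>x. \<phi> x \<in> \<rat>"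
proof -
  interpret vector_space_pair "\<lambda>(q::rat) (x::real). of_rat q * x" "(*) :: rat \<Rightarrow> rat \<Rightarrow> rat"
    by unfold_locales (auto simp: algebra_simps of_rat_add of_rat_mult)
  have "vs1.independent {1::real}"
    using vs1.dependent_single[of 1] by simp
  then obtain g :: "real \<Rightarrow> rat"
    where g: "Vector_Spaces.linear (\<lambda>q x. of_rat q * x) (*) g" "\<forall>x\<in>{1}. g x = 1"
    using linear_independent_extend[of "{1}" "\<lambda>_. 1"] by blast
  show thesis
  proof
    show "of_rat (g (x + y)) = (of_rat (g x) + of_rat (g y) :: real)" for x y
      using linear_add[OF g(1), of x y] by (simp add: of_rat_add)
  qed (use g(2) in auto)
qed

subsection \<open>Mass functions\<close>

lemma lookup_scaleR: "Poly_Mapping.lookup (c *\<^sub>R \<mu>) b = c * Poly_Mapping.lookup \<mu> b"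
  for \<mu> :: "'b \<Rightarrow>\<^sub>0 real"
proof -
  \<comment> \<open>\<open>scaleR\<close> is defined through the abstraction function of the type,
    so its \<open>lookup\<close> can be evaluated once the support is known to be finite.\<close>
  have "finite {b. c *\<^sub>R Poly_Mapping.lookup \<mu> b \<noteq> 0}"
    by (rule finite_subset[OF _ finite_keys[of \<mu>]]) (auto simp: in_keys_iff)
  then show ?thesis
    by (simp add: scaleR_poly_mapping_def)
qed

lemma mass_add: "mass (\<mu> + \<nu>) A = mass \<mu> A + mass \<nu> A"
  by (simp add: mass_def lookup_add sum.distrib)

lemma mass_diff: "mass (\<mu> - \<nu>) A = mass \<mu> A - mass \<nu> A"
  by (simp add: mass_def lookup_minus sum_subtractf)

lemma mass_scaleR: "mass (c *\<^sub>R \<mu>) A = c * mass \<mu> A"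
  by (simp add: mass_def lookup_scaleR sum_distrib_left)

lemma mass_uminus: "mass (- \<mu>) A = - mass \<mu> A"
  by (simp add: mass_def sum_negf)

text \<open>An additive map fixes 0, so \<open>Poly_Mapping.map\<close>, which acts on nonzero
  values only, agrees with pointwise application. Over an infinite \<open>A\<close> both sums are 0
  by convention.\<close>

lemma mass_map:
  assumes "\<And>x y. \<phi> (x + y) = \<phi> x + \<phi> y"
  shows "mass (Poly_Mapping.map \<phi> \<mu>) A = \<phi> (mass \<mu> A)"
proof -
  have "\<phi> 0 = 0"
    using assms[of 0 0] by simp
  then have "Poly_Mapping.lookup (Poly_Mapping.map \<phi> \<mu>) b = \<phi> (Poly_Mapping.lookup \<mu> b)" for b
    by (simp add: map.rep_eq when_def)
  moreover have "(\<Sum>b\<in>A. \<phi> (f b)) = \<phi> (\<Sum>b\<in>A. f b)" for f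
    using \<open>\<phi> 0 = 0\<close> by (induction A rule: infinite_finite_induct) (auto simp: assms)
  ultimately show ?thesis
    by (simp add: mass_def)
qed

subsection \<open>Simplices cut by equations between masses\<close>

text \<open>Equating two masses involves only the coefficients -1, 0 and 1, so every additive map
  sends solutions to solutions.\<close>

definition mass_system :: "('b set \<times> 'b set) set \<Rightarrow> ('b \<Rightarrow>\<^sub>0 real) \<Rightarrow> bool" where
  "mass_system R \<mu> \<longleftrightarrow> (\<forall>(A, B)\<in>R. mass \<mu> A = mass \<mu> B)"

definition cut_simplex :: "'b set \<Rightarrow> ('b set \<times> 'b set) set \<Rightarrow> ('b \<Rightarrow>\<^sub>0 real) set" where
  "cut_simplex S R = {\<mu>. Poly_Mapping.keys \<mu> \<subseteq> S \<and> (\<forall>b. 0 \<le> Poly_Mapping.lookup \<mu> b) \<and>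
     mass \<mu> S = 1 \<and> mass_system R \<mu>}"

definition cut_direction :: "'b set \<Rightarrow> ('b set \<times> 'b set) set \<Rightarrow> ('b \<Rightarrow>\<^sub>0 real) \<Rightarrow> bool" where
  "cut_direction S R d \<longleftrightarrow> d \<noteq> 0 \<and> mass d S = 0 \<and> mass_system R d"

text \<open>These are the basic feasible solutions of linear programming: on the support of
  \<open>\<mu>\<close>, the homogeneous system including total mass 0 has only the zero
  solution.\<close>

definition cut_vertices :: "'b set \<Rightarrow> ('b set \<times> 'b set) set \<Rightarrow> ('b \<Rightarrow>\<^sub>0 real) set" where
  "cut_vertices S R = {\<mu> \<in> cut_simplex S R.
     \<forall>d. Poly_Mapping.keys d \<subseteq> Poly_Mapping.keys \<mu> \<longrightarrow> \<not> cut_direction S R d}"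

lemma mass_system_add: "mass_system R \<mu> \<Longrightarrow> mass_system R \<nu> \<Longrightarrow> mass_system R (\<mu> + \<nu>)"
  by (simp add: mass_system_def mass_add case_prod_beta)

lemma mass_system_scaleR: "mass_system R \<mu> \<Longrightarrow> mass_system R (c *\<^sub>R \<mu>)"
  by (simp add: mass_system_def mass_scaleR case_prod_beta)

lemma cut_direction_uminus: "cut_direction S R d \<Longrightarrow> cut_direction S R (- d)"
  by (auto simp: cut_direction_def mass_system_def mass_uminus)

text \<open>Serves to compare a point of \<open>cut_vertices\<close> with another solution on its
  support. Signs are left free, since applying a rational projection may produce negative
  entries.\<close>

lemma cut_direction_diff:
  assumes "mass \<mu> S = mass \<nu> S" "mass_system R \<mu>" "mass_system R \<nu>" "\<mu> \<noteq> \<nu>"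
  shows "cut_direction S R (\<mu> - \<nu>)"
  using assms by (simp add: cut_direction_def mass_system_def mass_diff case_prod_beta)

lemma convex_cut_simplex: "convex (cut_simplex S R)"
proof (rule convexI)
  fix \<mu> \<nu> and u v :: real
  assume \<mu>: "\<mu> \<in> cut_simplex S R" and \<nu>: "\<nu> \<in> cut_simplex S R" and uv: "0 \<le> u" "0 \<le> v" "u + v = 1"
  have "Poly_Mapping.keys (u *\<^sub>R \<mu> + v *\<^sub>R \<nu>) \<subseteq> Poly_Mapping.keys \<mu> \<union> Poly_Mapping.keys \<nu>"
    by (auto simp: in_keys_iff lookup_add lookup_scaleR)
  then have "Poly_Mapping.keys (u *\<^sub>R \<mu> + v *\<^sub>R \<nu>) \<subseteq> S"
    using \<mu> \<nu> by (auto simp: cut_simplex_def)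
  moreover have "mass_system R (u *\<^sub>R \<mu> + v *\<^sub>R \<nu>)"
    using \<mu> \<nu> by (intro mass_system_add mass_system_scaleR) (auto simp: cut_simplex_def)
  ultimately show "u *\<^sub>R \<mu> + v *\<^sub>R \<nu> \<in> cut_simplex S R"
    using \<mu> \<nu> uv by (simp add: cut_simplex_def mass_add mass_scaleR lookup_add lookup_scaleR)
qed

text \<open>This is the ratio test of the simplex method: move along \<open>d\<close> until a first
  coordinate reaches zero. No new coordinate enters the support, because \<open>d\<close> vanishes
  outside it.\<close>

lemma cut_simplex_shrink_support:
  assumes S: "finite S" and \<mu>: "\<mu> \<in> cut_simplex S R"
    and d: "cut_direction S R d" "Poly_Mapping.keys d \<subseteq> Poly_Mapping.keys \<mu>"
  obtains t where "0 < t" "\<mu> + t *\<^sub>R d \<in> cut_simplex S R"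
    "Poly_Mapping.keys (\<mu> + t *\<^sub>R d) \<subset> Poly_Mapping.keys \<mu>"
proof -
  let ?m = "Poly_Mapping.lookup \<mu>" and ?d = "Poly_Mapping.lookup d"
  let ?N = "{b. ?d b < 0}"
  let ?r = "\<lambda>b. ?m b / - ?d b"
  have keys: "Poly_Mapping.keys \<mu> \<subseteq> S" "Poly_Mapping.keys d \<subseteq> S" and m0: "\<And>b. 0 \<le> ?m b"
    using \<mu> d(2) by (auto simp: cut_simplex_def)
  have N: "?N \<subseteq> Poly_Mapping.keys d"
    by (auto simp: in_keys_iff)
  then have fin: "finite ?N"
    using finite_keys by (rule finite_subset)
  \<comment> \<open>A nonzero direction of total mass 0 must be negative somewhere.\<close>
  have "?N \<noteq> {}"
  proof
    assume "?N = {}"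
    then have nonneg: "\<And>b. 0 \<le> ?d b"
      by (simp add: not_less)
    have "(\<Sum>b\<in>S. ?d b) = 0"
      using d(1) by (simp add: cut_direction_def mass_def)
    then have "\<forall>b\<in>S. ?d b = 0"
      using sum_nonneg_eq_0_iff[OF S] nonneg by auto
    then have "d = 0"
      using keys(2) by (intro poly_mapping_eqI) (metis in_keys_iff lookup_zero subsetD)
    then show False
      using d(1) by (simp add: cut_direction_def)
  qed
  \<comment> \<open>The largest step that keeps every coordinate nonnegative; at a minimiser of the
    ratio the coordinate becomes exactly zero.\<close>
  define t where "t = Min (?r ` ?N)"
  have "t \<in> ?r ` ?N"
    unfolding t_def using fin \<open>?N \<noteq> {}\<close> by (intro Min_in) auto
  then obtain b where b: "?d b < 0" "t = ?r b"
    by auto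
  have bk: "b \<in> Poly_Mapping.keys \<mu>"
    using b(1) N d(2) by auto
  have "0 < ?m b"
    using bk m0[of b] by (simp add: in_keys_iff order_less_le)
  then have t: "0 < t"
    unfolding b(2) using b(1) by (intro divide_pos_pos) auto
  have nonneg: "0 \<le> ?m c + t * ?d c" for c
  proof (cases "?d c < 0")
    case True
    then have "t \<le> ?r c"
      unfolding t_def using fin by (intro Min_le) auto
    with True show ?thesis
      by (simp add: field_simps)
  next
    case False
    then show ?thesis
      using t m0[of c] by simp
  qed
  have "Poly_Mapping.lookup (\<mu> + t *\<^sub>R d) b = 0"
    unfolding lookup_add lookup_scaleR using b by simp
  moreover have sub: "Poly_Mapping.keys (\<mu> + t *\<^sub>R d) \<subseteq> Poly_Mapping.keys \<mu>"
  proof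
    fix c assume "c \<in> Poly_Mapping.keys (\<mu> + t *\<^sub>R d)"
    then have "?m c \<noteq> 0 \<or> ?d c \<noteq> 0"
      by (auto simp: in_keys_iff lookup_add lookup_scaleR)
    then show "c \<in> Poly_Mapping.keys \<mu>"
      using d(2) by (metis in_keys_iff subsetD)
  qed
  ultimately have "Poly_Mapping.keys (\<mu> + t *\<^sub>R d) \<subset> Poly_Mapping.keys \<mu>"
    using bk by (auto simp: in_keys_iff)
  moreover have "mass_system R (\<mu> + t *\<^sub>R d)"
    using \<mu> d(1) by (intro mass_system_add mass_system_scaleR)
      (auto simp: cut_simplex_def cut_direction_def)
  then have "\<mu> + t *\<^sub>R d \<in> cut_simplex S R"
    using \<mu> d(1) sub nonneg
    by (auto simp: cut_simplex_def cut_direction_def mass_add mass_scaleR lookup_add lookup_scaleR)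
  ultimately show thesis
    using that t by blast
qed

lemma cut_simplex_between:
  assumes "finite S" "\<mu> \<in> cut_simplex S R" "\<mu> \<notin> cut_vertices S R"
  obtains \<alpha> \<beta> where "\<alpha> \<in> cut_simplex S R" "\<beta> \<in> cut_simplex S R"
    "Poly_Mapping.keys \<alpha> \<subset> Poly_Mapping.keys \<mu>" "Poly_Mapping.keys \<beta> \<subset> Poly_Mapping.keys \<mu>"
    "\<mu> \<in> open_segment \<alpha> \<beta>"
proof -
  obtain d where d: "cut_direction S R d" "Poly_Mapping.keys d \<subseteq> Poly_Mapping.keys \<mu>"
    using assms by (auto simp: cut_vertices_def)
  obtain t where t: "0 < t" "\<mu> + t *\<^sub>R d \<in> cut_simplex S R"
      "Poly_Mapping.keys (\<mu> + t *\<^sub>R d) \<subset> Poly_Mapping.keys \<mu>"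
    using cut_simplex_shrink_support[OF assms(1,2) d] .
  have "Poly_Mapping.keys (- d) \<subseteq> Poly_Mapping.keys \<mu>"
    using d(2) by (auto simp: in_keys_iff)
  then obtain s where s: "0 < s" "\<mu> + s *\<^sub>R (- d) \<in> cut_simplex S R"
      "Poly_Mapping.keys (\<mu> + s *\<^sub>R (- d)) \<subset> Poly_Mapping.keys \<mu>"
    using cut_simplex_shrink_support[OF assms(1,2) cut_direction_uminus[OF d(1)]] by blast
  \<comment> \<open>The weights are inversely proportional to the step lengths \<open>t\<close> and
    \<open>s\<close>, so that the two opposite displacements cancel.\<close>
  define u where "u = t / (s + t)"
  have u: "0 < u" "u < 1" "(1 - u) * t = u * s"
    using s(1) t(1) by (auto simp: u_def field_simps)
  have "(1 - u) *\<^sub>R (\<mu> + t *\<^sub>R d) + u *\<^sub>R (\<mu> + s *\<^sub>R (- d)) = \<mu> + ((1 - u) * t - u * s) *\<^sub>R d"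
    by (simp add: algebra_simps)
  then have "\<mu> = (1 - u) *\<^sub>R (\<mu> + t *\<^sub>R d) + u *\<^sub>R (\<mu> + s *\<^sub>R (- d))"
    using u(3) by simp
  moreover have "\<mu> + t *\<^sub>R d \<noteq> \<mu> + s *\<^sub>R (- d)"
  proof
    assume "\<mu> + t *\<^sub>R d = \<mu> + s *\<^sub>R (- d)"
    then have "(t + s) *\<^sub>R d = 0"
      by (simp add: algebra_simps)
    then show False
      using s(1) t(1) d(1) by (auto simp: cut_direction_def)
  qed
  ultimately have "\<mu> \<in> open_segment (\<mu> + t *\<^sub>R d) (\<mu> + s *\<^sub>R (- d))"
    using u(1,2) by (auto simp: in_segment)
  then show thesis
    using that s t by blast
qed

lemma extreme_point_in_cut_vertices:
  assumes "finite S" "\<mu> extreme_point_of cut_simplex S R"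
  shows "\<mu> \<in> cut_vertices S R"
  using assms cut_simplex_between[of S \<mu> R] unfolding extreme_point_of_def by metis

text \<open>A support determines at most one such point: the difference of two would be a direction
  excluded by the definition. Hence there are at most as many points as subsets of
  \<open>S\<close>.\<close>

lemma finite_cut_vertices:
  assumes "finite S"
  shows "finite (cut_vertices S R)"
proof (rule inj_on_finite)
  show "inj_on Poly_Mapping.keys (cut_vertices S R)"
  proof (rule inj_onI, rule ccontr)
    fix \<mu> \<nu>
    assume \<mu>: "\<mu> \<in> cut_vertices S R" and \<nu>: "\<nu> \<in> cut_vertices S R"
      and eq: "Poly_Mapping.keys \<mu> = Poly_Mapping.keys \<nu>" and "\<mu> \<noteq> \<nu>"
    then have "cut_direction S R (\<mu> - \<nu>)"
      by (intro cut_direction_diff) (auto simp: cut_vertices_def cut_simplex_def)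
    moreover have "Poly_Mapping.keys (\<mu> - \<nu>) \<subseteq> Poly_Mapping.keys \<mu>"
      using keys_diff[of \<mu> \<nu>] eq by simp
    ultimately show False
      using \<mu> by (auto simp: cut_vertices_def)
  qed
  show "Poly_Mapping.keys ` cut_vertices S R \<subseteq> Pow S"
    by (auto simp: cut_vertices_def cut_simplex_def)
qed (use assms in simp)

text \<open>Strong induction on the size of the support. A separate base case does not arise: a
  point whose support cannot shrink already lies in \<open>cut_vertices\<close>.\<close>

lemma cut_simplex_eq_hull:
  assumes "finite S"
  shows "cut_simplex S R = convex hull cut_vertices S R"
proof
  have "\<mu> \<in> convex hull cut_vertices S R" if "\<mu> \<in> cut_simplex S R" for \<mu>
    using that
  proof (induction "card (Poly_Mapping.keys \<mu>)" arbitrary: \<mu> rule: less_induct)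
    case less
    show ?case
    proof (cases "\<mu> \<in> cut_vertices S R")
      case True
      then show ?thesis
        by (rule hull_inc)
    next
      case False
      then obtain \<alpha> \<beta> where ab: "\<alpha> \<in> cut_simplex S R" "\<beta> \<in> cut_simplex S R"
        "Poly_Mapping.keys \<alpha> \<subset> Poly_Mapping.keys \<mu>" "Poly_Mapping.keys \<beta> \<subset> Poly_Mapping.keys \<mu>"
        "\<mu> \<in> open_segment \<alpha> \<beta>"
        using cut_simplex_between[OF assms less.prems] by blast
      then have "\<alpha> \<in> convex hull cut_vertices S R" "\<beta> \<in> convex hull cut_vertices S R"
        by (auto intro!: less.hyps psubset_card_mono)
      then have "closed_segment \<alpha> \<beta> \<subseteq> convex hull cut_vertices S R"
        by (simp add: closed_segment_subset)
      then show ?thesis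
        using ab(5) segment_open_subset_closed by blast
    qed
  qed
  then show "cut_simplex S R \<subseteq> convex hull cut_vertices S R"
    by blast
  show "convex hull cut_vertices S R \<subseteq> cut_simplex S R"
    by (intro hull_minimal convex_cut_simplex) (auto simp: cut_vertices_def)
qed

lemma cut_vertices_rational:
  assumes \<mu>: "\<mu> \<in> cut_vertices S R"
  shows "Poly_Mapping.lookup \<mu> b \<in> \<rat>"
proof -
  obtain \<phi> :: "real \<Rightarrow> real"
    where \<phi>: "\<And>x y. \<phi> (x + y) = \<phi> x + \<phi> y" "\<phi> 1 = 1" "\<And>x. \<phi> x \<in> \<rat>"
    using rational_projection by blast
  let ?\<nu> = "Poly_Mapping.map \<phi> \<mu>"
  have "mass ?\<nu> A = \<phi> (mass \<mu> A)" for A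
    using \<phi>(1) by (rule mass_map)
  \<comment> \<open>Additivity preserves the equations, and \<open>\<phi> 1 = 1\<close> preserves
    the total mass 1.\<close>
  then have sys: "mass \<mu> S = mass ?\<nu> S" "mass_system R \<mu>" "mass_system R ?\<nu>"
    using \<mu> \<phi>(2) by (auto simp: cut_vertices_def cut_simplex_def mass_system_def)
  \<comment> \<open>Zero coordinates stay zero, so a nonzero difference would be a direction on the
    support of \<open>\<mu>\<close>.\<close>
  have "Poly_Mapping.keys (\<mu> - ?\<nu>) \<subseteq> Poly_Mapping.keys \<mu>"
    by (auto simp: in_keys_iff lookup_minus map.rep_eq when_def)
  then have "\<mu> = ?\<nu>"
    using \<mu> cut_direction_diff[OF sys] by (auto simp: cut_vertices_def)
  then have "Poly_Mapping.lookup \<mu> b = Poly_Mapping.lookup ?\<nu> b"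
    by simp
  also have "\<dots> \<in> \<rat>"
    using \<phi>(3) by (simp add: map.rep_eq when_def)
  finally show ?thesis .
qed

subsection \<open>Locally invariant measures\<close>

lemma finite_box_sites: "finite (box_sites n :: (int ^ 'd::finite) set)"
proof (rule finite_subset)
  show "box_sites n \<subseteq> vec_lambda ` (UNIV \<rightarrow>\<^sub>E {- int n..int n} :: ('d \<Rightarrow> int) set)"
  proof
    fix v :: "int ^ 'd"
    assume "v \<in> box_sites n"
    then show "v \<in> vec_lambda ` (UNIV \<rightarrow>\<^sub>E {- int n..int n})"
      by (intro image_eqI[of _ _ "vec_nth v"]) (auto simp: box_sites_def)
  qed
qed (intro finite_imageI finite_PiE; simp)

text \<open>Each instance of local invariance equates the masses of two cylinders, which is the form
  of equation that \<open>mass_system\<close> collects.\<close>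

lemma loc_inv_measures_eq_cut_simplex:
  "loc_inv_measures \<Sigma> n = cut_simplex (configs \<Sigma> n)
     {(cylinder \<Sigma> n E a, cylinder \<Sigma> n (translate_set u E) (translate_pattern u E a)) | E a u.
        E \<subseteq> box_sites n \<and> a \<in> E \<rightarrow>\<^sub>E \<Sigma> \<and> translate_set u E \<subseteq> box_sites n}"
  unfolding loc_inv_measures_def prob_measures_def locally_invariant_def cut_simplex_def
    mass_system_def by blast

theorem theorem1:
  fixes \<Sigma> :: "'a set" and n :: nat
  assumes "finite \<Sigma>"
  shows "polytope (loc_inv_measures \<Sigma> n :: ((int ^ 'd::finite \<Rightarrow> 'a) \<Rightarrow>\<^sub>0 real) set) \<and>
         (\<forall>\<mu> :: (int ^ 'd \<Rightarrow> 'a) \<Rightarrow>\<^sub>0 real.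
            \<mu> extreme_point_of (loc_inv_measures \<Sigma> n) \<longrightarrow>
            (\<forall>A \<subseteq> configs \<Sigma> n. mass \<mu> A \<in> \<rat>))"
proof -
  have fin: "finite (configs \<Sigma> n :: (int ^ 'd \<Rightarrow> 'a) set)"
    unfolding configs_def using assms finite_box_sites by (intro finite_PiE)
  obtain R where R:
    "(loc_inv_measures \<Sigma> n :: ((int ^ 'd \<Rightarrow> 'a) \<Rightarrow>\<^sub>0 real) set) = cut_simplex (configs \<Sigma> n) R"
    using loc_inv_measures_eq_cut_simplex by blast
  have "polytope (cut_simplex (configs \<Sigma> n :: (int ^ 'd \<Rightarrow> 'a) set) R)"
    unfolding polytope_def using cut_simplex_eq_hull[OF fin] finite_cut_vertices[OF fin] by blast
  \<comment> \<open>Rational point masses have rational sums.\<close>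
  moreover have "mass \<mu> A \<in> \<rat>" if "\<mu> extreme_point_of cut_simplex (configs \<Sigma> n) R"
    for \<mu> :: "(int ^ 'd \<Rightarrow> 'a) \<Rightarrow>\<^sub>0 real" and A
    unfolding mass_def
    using cut_vertices_rational[OF extreme_point_in_cut_vertices[OF fin that]] by blast
  ultimately show ?thesis
    unfolding R by blast
qed

end
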